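(* Let $\Gamma$ be a finitely generated, infinite group, let $\mathcal G$ be the Cayley graph of $\Gamma$ with respect to a finite symmetric generating set and let $\mathbb P$ be a $\Gamma$-invariant bond percolation on $\mathcal G$ whose two-point function $\tau(o,\cdot)$ vanishes at infinity. Then $\mathbb P$-almost surely there are either only finite clusters or infinitely many infinite clusters.
   Context: Right Cayley graph: vertex set $\Gamma$, edge set $E=\{[g,gs]: g\in\Gamma, s\in S\}$ with $S$ a finite symmetric generating set; $o$ is the identity, $d$ the graph distance. $\Gamma$ acts by left multiplication. A $\Gamma$-invariant bond percolation is a probability measure $\mathbb P$ on subsets $\omega\subset E$ invariant under $\Gamma$; clusters are connected components of $(\Gamma,\omega)$; $\tau(g,h)=\mathbb P[g\leftrightarrow h]$ is the probability that $g,h$ are in the same cluster. $\tau(o,\cdot)$ vanishes at infinity (written $\tau(o,\cdot)\in C_0(\Gamma)$) if $\lim_{r\to\infty}\sup_{d(g,h)>r}\tau(g,h)=0$. *)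

theory Defs
  imports "HOL-Probability.Probability" "HOL-Algebra.Generated_Groups"
begin

definition finite_symmetric_generating_set ::
    "('a, 'b) monoid_scheme \<Rightarrow> 'a set \<Rightarrow> bool" where
  "finite_symmetric_generating_set G S \<longleftrightarrow>
     finite S \<and> S \<subseteq> carrier G \<and> (\<forall>s\<in>S. inv\<^bsub>G\<^esub> s \<in> S) \<and> generate G S = carrier G"

text \<open>An unoriented edge is the set of its endpoints, so a loop (present only if the
  identity belongs to the generating set) is a singleton.\<close>

definition cayley_edges :: "('a, 'b) monoid_scheme \<Rightarrow> 'a set \<Rightarrow> 'a set set" where
  "cayley_edges G S = {{g, g \<otimes>\<^bsub>G\<^esub> s} | g s. g \<in> carrier G \<and> s \<in> S}"

definition adjacency :: "'a set set \<Rightarrow> ('a \<times> 'a) set" where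
  "adjacency F = {(x, y). {x, y} \<in> F}"

text \<open>Length of a shortest path. The value is meaningful only for connected vertices, which
  covers all pairs of vertices of a Cayley graph.\<close>

definition graph_dist :: "'a set set \<Rightarrow> 'a \<Rightarrow> 'a \<Rightarrow> nat" where
  "graph_dist F x y = (LEAST n. (x, y) \<in> adjacency F ^^ n)"

definition linked :: "'a set set \<Rightarrow> 'a \<Rightarrow> 'a \<Rightarrow> bool" where
  "linked \<omega> x y \<longleftrightarrow> (x, y) \<in> (adjacency \<omega>)\<^sup>*"

definition clusters :: "('a, 'b) monoid_scheme \<Rightarrow> 'a set set \<Rightarrow> 'a set set" where
  "clusters G \<omega> = (\<lambda>g. {h \<in> carrier G. linked \<omega> g h}) ` carrier G"

text \<open>The \<open>\<sigma>\<close>-algebra on subsets of \<open>E\<close> is the product one, generated by the events that a given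
  edge is open. The measure that \<^const>\<open>sigma\<close> attaches to this space plays no role.\<close>

definition configurations :: "'a set set \<Rightarrow> 'a set set measure" where
  "configurations E = sigma (Pow E) ((\<lambda>e. {\<omega> \<in> Pow E. e \<in> \<omega>}) ` E)"

definition bond_percolation :: "'a set set \<Rightarrow> 'a set set measure \<Rightarrow> bool" where
  "bond_percolation E P \<longleftrightarrow> prob_space P \<and> sets P = sets (configurations E)"

definition translate ::
    "('a, 'b) monoid_scheme \<Rightarrow> 'a \<Rightarrow> 'a set set \<Rightarrow> 'a set set" where
  "translate G g \<omega> = (\<lambda>e. (\<lambda>x. g \<otimes>\<^bsub>G\<^esub> x) ` e) ` \<omega>"

definition translation_invariant ::
    "('a, 'b) monoid_scheme \<Rightarrow> 'a set set measure \<Rightarrow> bool" where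
  "translation_invariant G P \<longleftrightarrow> (\<forall>g \<in> carrier G. distr P P (translate G g) = P)"

definition two_point :: "'a set set measure \<Rightarrow> 'a \<Rightarrow> 'a \<Rightarrow> real" where
  "two_point P g h = measure P {\<omega> \<in> space P. linked \<omega> g h}"

definition vanishes_at_infinity ::
    "('a, 'b) monoid_scheme \<Rightarrow> 'a set \<Rightarrow> ('a \<Rightarrow> 'a \<Rightarrow> real) \<Rightarrow> bool" where
  "vanishes_at_infinity G S f \<longleftrightarrow>
     (\<lambda>r::nat. SUP (g, h) \<in> {(g, h). g \<in> carrier G \<and> h \<in> carrier G \<and>
                                graph_dist (cayley_edges G S) g h > r}. f g h)
       \<longlonglongrightarrow> 0"

lemma space_percolation:
  assumes "bond_percolation E P"
  shows "space P = Pow E"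
proof -
  have "space P = space (configurations E)"
    using assms by (intro sets_eq_imp_space_eq) (simp add: bond_percolation_def)
  then show ?thesis by (auto simp: configurations_def space_measure_of_conv)
qed

lemma edge_open_event:
  assumes P: "bond_percolation E P"
  shows "{\<omega> \<in> space P. e \<in> \<omega>} \<in> sets P"
proof (cases "e \<in> E")
  case True
  then have "{\<omega> \<in> Pow E. e \<in> \<omega>} \<in> sets (configurations E)"
    unfolding configurations_def by (subst sets_measure_of) auto
  with P show ?thesis by (simp add: space_percolation[OF P] bond_percolation_def)
next
  case False
  then have "{\<omega> \<in> space P. e \<in> \<omega>} = {}" by (auto simp: space_percolation[OF P])
  then show ?thesis by (simp only: sets.empty_sets)
qed

lemma countable_cayley:
  assumes G: "group G" and S: "finite_symmetric_generating_set G S"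
  shows "countable (carrier G)"
proof -
  interpret group G by (rule G)
  have fin: "finite S" and sub: "S \<subseteq> carrier G" and gen: "generate G S = carrier G"
    using S by (auto simp: finite_symmetric_generating_set_def)
  let ?f = "\<lambda>xs. foldr (\<lambda>s a. s \<otimes>\<^bsub>G\<^esub> a) xs \<one>\<^bsub>G\<^esub>"
  have app: "?f (xs @ ys) = ?f xs \<otimes>\<^bsub>G\<^esub> ?f ys \<and> ?f xs \<in> carrier G \<and> ?f ys \<in> carrier G"
    if "set xs \<subseteq> S" "set ys \<subseteq> S" for xs ys
  proof -
    have cl: "?f zs \<in> carrier G" if "set zs \<subseteq> S" for zs
      using that sub by (induction zs) auto
    show ?thesis using that sub cl
      by (induction xs) (auto simp: m_assoc subset_iff)
  qed
  have "generate G S \<subseteq> ?f ` lists S"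
  proof
    fix x assume "x \<in> generate G S"
    then show "x \<in> ?f ` lists S"
    proof (induction rule: generate.induct)
      case one then show ?case by (intro image_eqI[of _ _ "[]"]) auto
    next
      case (incl h) then show ?case using sub by (intro image_eqI[of _ _ "[h]"]) auto
    next
      case (inv h)
      then have "inv\<^bsub>G\<^esub> h \<in> S" using S by (auto simp: finite_symmetric_generating_set_def)
      then show ?case using sub by (intro image_eqI[of _ _ "[inv\<^bsub>G\<^esub> h]"]) auto
    next
      case (eng a b)
      then obtain xs ys where xy: "a = ?f xs" "b = ?f ys" "xs \<in> lists S" "ys \<in> lists S" by auto
      then have "set xs \<subseteq> S" "set ys \<subseteq> S" by auto
      then have "a \<otimes>\<^bsub>G\<^esub> b = ?f (xs @ ys)" using app xy by metis
      then show ?case using xy by (intro image_eqI[of _ _ "xs @ ys"]) auto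
    qed
  qed
  moreover have "countable (lists S)" using fin by (intro countable_lists countable_finite)
  ultimately show ?thesis using gen by (metis countable_image countable_subset)
qed

lemma adjacent_in_carrier:
  assumes "group G" "finite_symmetric_generating_set G S" "\<omega> \<subseteq> cayley_edges G S"
    "(x, y) \<in> adjacency \<omega>"
  shows "x \<in> carrier G \<and> y \<in> carrier G"
proof -
  interpret group G by fact
  have "{x, y} \<in> cayley_edges G S" using assms by (auto simp: adjacency_def)
  then obtain g s where "{x, y} = {g, g \<otimes>\<^bsub>G\<^esub> s}" "g \<in> carrier G" "s \<in> S"
    by (auto simp: cayley_edges_def)
  moreover have "s \<in> carrier G" 
    using \<open>s \<in> S\<close> assms(2) by (auto simp: finite_symmetric_generating_set_def)
  ultimately show ?thesis by (auto simp: doubleton_eq_iff)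
qed

lemma linked_event:
  assumes G: "group G" and S: "finite_symmetric_generating_set G S"
    and P: "bond_percolation (cayley_edges G S) P"
  shows "{\<omega> \<in> space P. linked \<omega> g h} \<in> sets P"
proof -
  have step: "{\<omega> \<in> space P. (g, h) \<in> adjacency \<omega> ^^ n} \<in> sets P" for n h
  proof (induction n arbitrary: h)
    case 0 then show ?case by (cases "g = h") auto
  next
    case (Suc n)
    have "{\<omega> \<in> space P. (g, h) \<in> adjacency \<omega> ^^ Suc n} =
        (\<Union>k\<in>carrier G. {\<omega> \<in> space P. (g, k) \<in> adjacency \<omega> ^^ n} \<inter> {\<omega> \<in> space P. {k, h} \<in> \<omega>})"
      using adjacent_in_carrier[OF G S]
      by (fastforce simp: space_percolation[OF P] adjacency_def)
    then show ?case
      using Suc edge_open_event[OF P] countable_cayley[OF G S]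
      by (auto intro!: sets.countable_UN' sets.Int)
  qed
  have "{\<omega> \<in> space P. linked \<omega> g h} = (\<Union>n. {\<omega> \<in> space P. (g, h) \<in> adjacency \<omega> ^^ n})"
    by (auto simp: linked_def rtrancl_power)
  then show ?thesis using step by auto
qed

lemma translate_measurable:
  assumes G: "group G" and S: "finite_symmetric_generating_set G S"
    and P: "bond_percolation (cayley_edges G S) P" and g: "g \<in> carrier G"
  shows "translate G g \<in> measurable P P"
proof -
  interpret group G by (rule G)
  let ?E = "cayley_edges G S"
  have SG: "S \<subseteq> carrier G" using S by (auto simp: finite_symmetric_generating_set_def)
  have sub: "e \<subseteq> carrier G" if "e \<in> ?E" for e
    using that SG by (auto simp: cayley_edges_def)
  have maps: "(\<lambda>x. k \<otimes>\<^bsub>G\<^esub> x) ` e \<in> ?E" if ke: "e \<in> ?E" "k \<in> carrier G" for e k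
  proof -
    obtain x s where x: "e = {x, x \<otimes>\<^bsub>G\<^esub> s}" "x \<in> carrier G" "s \<in> S"
      using ke by (auto simp: cayley_edges_def)
    then have "(\<lambda>x. k \<otimes>\<^bsub>G\<^esub> x) ` e = {k \<otimes>\<^bsub>G\<^esub> x, (k \<otimes>\<^bsub>G\<^esub> x) \<otimes>\<^bsub>G\<^esub> s}"
      using ke SG by (auto simp: m_assoc)
    then show ?thesis unfolding cayley_edges_def using x ke by blast
  qed
  have canc: "(\<lambda>x. k \<otimes>\<^bsub>G\<^esub> x) ` ((\<lambda>x. inv\<^bsub>G\<^esub> k \<otimes>\<^bsub>G\<^esub> x) ` e) = e"
    if "k \<in> carrier G" "e \<subseteq> carrier G" for k e
  proof -
    have "k \<otimes>\<^bsub>G\<^esub> (inv\<^bsub>G\<^esub> k \<otimes>\<^bsub>G\<^esub> x) = x" if "x \<in> e" for x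
      using that \<open>k \<in> carrier G\<close> \<open>e \<subseteq> carrier G\<close> by (auto simp: m_assoc[symmetric])
    then show ?thesis by (simp add: image_image)
  qed
  have mem: "e \<in> translate G g \<omega> \<longleftrightarrow> (\<lambda>x. inv\<^bsub>G\<^esub> g \<otimes>\<^bsub>G\<^esub> x) ` e \<in> \<omega>"
    if e: "e \<in> ?E" and w: "\<omega> \<subseteq> ?E" for e \<omega>
  proof
    assume "e \<in> translate G g \<omega>"
    then obtain f where f: "f \<in> \<omega>" "e = (\<lambda>x. g \<otimes>\<^bsub>G\<^esub> x) ` f" by (auto simp: translate_def)
    have "(\<lambda>x. inv\<^bsub>G\<^esub> g \<otimes>\<^bsub>G\<^esub> x) ` e = f"
      using canc[of "inv\<^bsub>G\<^esub> g" f] sub f w g by auto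
    then show "(\<lambda>x. inv\<^bsub>G\<^esub> g \<otimes>\<^bsub>G\<^esub> x) ` e \<in> \<omega>" using f by simp
  next
    assume "(\<lambda>x. inv\<^bsub>G\<^esub> g \<otimes>\<^bsub>G\<^esub> x) ` e \<in> \<omega>"
    then show "e \<in> translate G g \<omega>"
      unfolding translate_def using canc[OF g sub[OF e]] by (metis image_eqI)
  qed
  have "translate G g \<in> measurable P (configurations ?E)"
    unfolding configurations_def
  proof (rule measurable_measure_of)
    show "translate G g \<in> space P \<rightarrow> Pow ?E"
    proof
      fix \<omega> assume "\<omega> \<in> space P"
      then have w: "\<omega> \<subseteq> ?E" by (simp add: space_percolation[OF P])
      show "translate G g \<omega> \<in> Pow ?E"
        unfolding translate_def using maps[OF _ g] w by blast
    qed
  next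
    fix A assume "A \<in> (\<lambda>e. {\<omega> \<in> Pow ?E. e \<in> \<omega>}) ` ?E"
    then obtain e where e: "e \<in> ?E" "A = {\<omega> \<in> Pow ?E. e \<in> \<omega>}" by auto
    have "translate G g -` A \<inter> space P = {\<omega> \<in> space P. (\<lambda>x. inv\<^bsub>G\<^esub> g \<otimes>\<^bsub>G\<^esub> x) ` e \<in> \<omega>}"
    proof -
      have "\<omega> \<in> translate G g -` A \<longleftrightarrow> (\<lambda>x. inv\<^bsub>G\<^esub> g \<otimes>\<^bsub>G\<^esub> x) ` e \<in> \<omega>"
        if "\<omega> \<in> space P" for \<omega>
      proof -
        have w: "\<omega> \<subseteq> ?E" using that by (simp add: space_percolation[OF P])
        have "translate G g \<omega> \<subseteq> ?E"
          unfolding translate_def using maps[OF _ g] w by blast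
        then show ?thesis using mem[OF e(1) w] e(2) by simp
      qed
      then show ?thesis by blast
    qed
    then show "translate G g -` A \<inter> space P \<in> sets P" using edge_open_event[OF P] by simp
  qed auto
  moreover have "sets P = sets (configurations ?E)" using P by (simp add: bond_percolation_def)
  ultimately show ?thesis by (simp cong: measurable_cong_sets)
qed

end

theory Submission
  imports Defs
begin

text \<open>Suppose that with positive probability there is an infinite cluster and at most \<open>k\<close> of them.
  By invariance every vertex then has the same probability \<open>p > 0\<close> of lying in an infinite cluster
  while this happens. Among \<open>n\<close> vertices, on this event, the number of those in infinite clusters
  exceeds \<open>k\<close> by at most the number of connected pairs. Taking expectations gives
  \<open>n p \<le> k + n\<^sup>2 sup \<tau>\<close>, the supremum being over pairs of the chosen vertices. First choose \<open>n\<close> with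
  \<open>n p > k + 1\<close>, then place the vertices so far apart that \<open>n\<^sup>2 sup \<tau> < 1\<close>: a contradiction.\<close>

section \<open>Counting a finite set by unrelated points and related pairs\<close>

text \<open>Greedy choice: a new point \<open>a\<close> either joins \<open>U\<close> or is related
  to some \<open>u\<close> in \<open>U\<close>, and then the pair \<open>(a, u)\<close>, which did
  not occur before, pays for it. In the application \<open>R\<close> is being linked, so the points
  of \<open>U\<close> lie in distinct clusters.\<close>

lemma finite_set_card_le_independent_plus_pairs:
  assumes "finite X" and "\<And>x y. R x y \<Longrightarrow> R y x"
  shows "\<exists>U\<subseteq>X. (\<forall>x\<in>U. \<forall>y\<in>U. x \<noteq> y \<longrightarrow> \<not> R x y) \<and>
           card X \<le> card U + card {(x, y) \<in> X \<times> X. x \<noteq> y \<and> R x y}"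
  using assms(1)
proof induction
  case empty
  show ?case by auto
next
  case (insert a X)
  let ?pairs = "\<lambda>X. {(x, y) \<in> X \<times> X. x \<noteq> y \<and> R x y}"
  have fin: "finite (?pairs (insert a X))"
    by (rule finite_subset[of _ "insert a X \<times> insert a X"]) (use insert in auto)
  obtain U where U: "U \<subseteq> X" "\<forall>x\<in>U. \<forall>y\<in>U. x \<noteq> y \<longrightarrow> \<not> R x y"
    "card X \<le> card U + card (?pairs X)"
    using insert.IH by blast
  show ?case
  proof (cases "\<exists>u\<in>U. R a u")
    case False
    have "card (?pairs X) \<le> card (?pairs (insert a X))"
      by (rule card_mono[OF fin]) auto
    moreover have "card (insert a U) = Suc (card U)"
      using U(1) insert.hyps finite_subset by (subst card_insert_disjoint) auto
    ultimately have "card (insert a X) \<le> card (insert a U) + card (?pairs (insert a X))"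
      using U(3) insert.hyps by simp
    moreover have "\<forall>x\<in>insert a U. \<forall>y\<in>insert a U. x \<noteq> y \<longrightarrow> \<not> R x y"
      using False U(2) assms(2) by blast
    ultimately show ?thesis using U(1) by (intro exI[of _ "insert a U"]) blast
  next
    case True
    then obtain u where u: "u \<in> U" "R a u" by blast
    have "finite (?pairs X)" by (rule finite_subset[OF _ fin]) auto
    then have "Suc (card (?pairs X)) = card (insert (a, u) (?pairs X))"
      using insert.hyps by simp
    also have "\<dots> \<le> card (?pairs (insert a X))"
      using u U(1) insert.hyps by (intro card_mono[OF fin]) auto
    finally have "card (insert a X) \<le> card U + card (?pairs (insert a X))"
      using U(3) insert.hyps by simp
    then show ?thesis using U by blast
  qed
qed

text \<open>Serves quantifiers over finite vertex sets: these form a countable set inside a type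
  that may be uncountable.\<close>

lemma pred_Ball_countable:
  assumes "countable I" "\<And>i. i \<in> I \<Longrightarrow> Measurable.pred M (\<lambda>x. Q i x)"
  shows "Measurable.pred M (\<lambda>x. \<forall>i\<in>I. Q i x)"
  using assms unfolding pred_def by (intro sets.sets_Collect_countable_All')

lemma pred_Bex_countable:
  assumes "countable I" "\<And>i. i \<in> I \<Longrightarrow> Measurable.pred M (\<lambda>x. Q i x)"
  shows "Measurable.pred M (\<lambda>x. \<exists>i\<in>I. Q i x)"
  using assms unfolding pred_def by (intro sets.sets_Collect_countable_Ex')

lemma sum_indicator_family_eq_card:
  "finite A \<Longrightarrow> (\<Sum>i\<in>A. indicator (F i) x) = real (card {i \<in> A. x \<in> F i})"
  by (simp add: indicator_def Collect_conj_eq)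

section \<open>Symmetry of links and of the graph distance\<close>

lemma sym_adjacency: "sym (adjacency F)"
  by (auto simp: sym_def adjacency_def insert_commute)

lemma linked_sym: "linked \<omega> x y \<Longrightarrow> linked \<omega> y x"
  unfolding linked_def using sym_adjacency sym_rtrancl symD by metis

lemma linked_trans: "linked \<omega> x y \<Longrightarrow> linked \<omega> y z \<Longrightarrow> linked \<omega> x z"
  unfolding linked_def by (rule rtrancl_trans)

lemma graph_dist_commute: "graph_dist F x y = graph_dist F y x"
proof -
  have "(y, x) \<in> adjacency F ^^ n" if "(x, y) \<in> adjacency F ^^ n" for x y n
    using that
  proof (induction n arbitrary: y)
    case (Suc n)
    then obtain z where "(z, x) \<in> adjacency F ^^ n" "(y, z) \<in> adjacency F"
      by (auto dest: symD[OF sym_adjacency])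
    then show ?case by (rule relpow_Suc_I2[rotated])
  qed auto
  then show ?thesis unfolding graph_dist_def by metis
qed

section \<open>Geometry of the Cayley graph: connectedness, finite balls, separated sets\<close>

locale cayley_graph = group G for G :: "('a, 'b) monoid_scheme" (structure) +
  fixes S :: "'a set"
  assumes generating: "finite_symmetric_generating_set G S"
begin

abbreviation "E \<equiv> cayley_edges G S"

lemma generators_subset: "S \<subseteq> carrier G"
  using generating by (auto simp: finite_symmetric_generating_set_def)

lemma edge_subset: "e \<in> E \<Longrightarrow> e \<subseteq> carrier G"
  using generators_subset by (auto simp: cayley_edges_def)

lemma linked_edges:
  assumes "g \<in> carrier G" "h \<in> carrier G"
  shows "linked E g h"
proof -
  have edge: "linked E g (g \<otimes> s)" if "g \<in> carrier G" "s \<in> S" for g s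
    using that by (auto simp: linked_def adjacency_def cayley_edges_def)
  \<comment> \<open>The base point is quantified inside the induction because the second factor of a
    product is walked starting from \<open>g \<otimes> a\<close>.\<close>
  have "\<forall>g\<in>carrier G. linked E g (g \<otimes> a)" if "a \<in> generate G S" for a
    using that
  proof induction
    case one
    show ?case by (auto simp: linked_def)
  next
    case (incl s)
    then show ?case using edge by auto
  next
    case (inv s)
    then show ?case
      using edge generating by (auto simp: finite_symmetric_generating_set_def)
  next
    case (eng a b)
    have "a \<in> carrier G" "b \<in> carrier G"
      using eng.hyps generating by (auto simp: finite_symmetric_generating_set_def)
    then show ?case
      using eng.IH by (metis linked_trans m_assoc m_closed)
  qed
  moreover have "inv g \<otimes> h \<in> generate G S"
    using assms generating by (auto simp: finite_symmetric_generating_set_def)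
  ultimately have "linked E g (g \<otimes> (inv g \<otimes> h))" using assms by blast
  then show ?thesis using assms by (simp add: m_assoc[symmetric])
qed

text \<open>The graph is locally finite: the neighbours of \<open>k\<close> lie among the products
  of \<open>k\<close> with generators. Induction on the length of the walk then gives finitely many
  endpoints.\<close>

lemma finite_sphere_relpow:
  assumes "g \<in> carrier G"
  shows "finite {h. (g, h) \<in> adjacency E ^^ n}"
proof (induction n)
  case 0
  show ?case by simp
next
  case (Suc n)
  have nb: "finite {h. (k, h) \<in> adjacency E}" for k
  proof (rule finite_subset)
    show "{h. (k, h) \<in> adjacency E} \<subseteq> (\<lambda>s. k \<otimes> s) ` S"
    proof
      fix h assume "h \<in> {h. (k, h) \<in> adjacency E}"
      then obtain x s where x: "{k, h} = {x, x \<otimes> s}" "x \<in> carrier G" "s \<in> S"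
        by (auto simp: adjacency_def cayley_edges_def)
      have s: "s \<in> carrier G" using x(3) generators_subset by auto
      \<comment> \<open>Edges have no orientation, so \<open>k\<close> may be the endpoint
        \<open>x \<otimes> s\<close>. Then \<open>h\<close> is \<open>k \<otimes> inv s\<close>, and
        symmetry of \<open>S\<close> puts it in the image.\<close>
      have "inv s \<in> S" using x(3) generating by (auto simp: finite_symmetric_generating_set_def)
      moreover have "x = (x \<otimes> s) \<otimes> inv s" using x(2) s by (simp add: m_assoc)
      ultimately show "h \<in> (\<lambda>s. k \<otimes> s) ` S"
        using x by (auto simp: doubleton_eq_iff)
    qed
    show "finite ((\<lambda>s. k \<otimes> s) ` S)"
      using generating by (simp add: finite_symmetric_generating_set_def)
  qed
  have "{h. (g, h) \<in> adjacency E ^^ Suc n} =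
      (\<Union>k\<in>{k. (g, k) \<in> adjacency E ^^ n}. {h. (k, h) \<in> adjacency E})"
    by auto
  then show ?case using Suc nb by simp
qed

lemma finite_ball:
  assumes "g \<in> carrier G"
  shows "finite {h \<in> carrier G. graph_dist E g h \<le> r}"
proof (rule finite_subset)
  show "{h \<in> carrier G. graph_dist E g h \<le> r} \<subseteq> (\<Union>n\<le>r. {h. (g, h) \<in> adjacency E ^^ n})"
  proof
    fix h assume h: "h \<in> {h \<in> carrier G. graph_dist E g h \<le> r}"
    then obtain n where "(g, h) \<in> adjacency E ^^ n"
      using linked_edges[OF assms] by (auto simp: linked_def rtrancl_power)
    \<comment> \<open>Connectedness supplied some length, so the \<open>LEAST\<close> in
      \<open>graph_dist\<close> is attained.\<close>
    then have "(g, h) \<in> adjacency E ^^ graph_dist E g h"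
      unfolding graph_dist_def by (rule LeastI)
    then show "h \<in> (\<Union>n\<le>r. {h. (g, h) \<in> adjacency E ^^ n})" using h by blast
  qed
qed (use finite_sphere_relpow[OF assms] in simp)

text \<open>Points are added one at a time: the finitely many finite balls around the points already
  chosen cannot cover an infinite group.\<close>

lemma ex_separated_set:
  assumes "infinite (carrier G)"
  shows "\<exists>T\<subseteq>carrier G. finite T \<and> card T = n \<and>
           (\<forall>x\<in>T. \<forall>y\<in>T. x \<noteq> y \<longrightarrow> graph_dist E x y > r)"
proof (induction n)
  case 0
  show ?case by auto
next
  case (Suc n)
  then obtain T where T: "T \<subseteq> carrier G" "finite T" "card T = n"
    "\<forall>x\<in>T. \<forall>y\<in>T. x \<noteq> y \<longrightarrow> graph_dist E x y > r"
    by blast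
  let ?U = "T \<union> (\<Union>x\<in>T. {h \<in> carrier G. graph_dist E x h \<le> r})"
  have "finite ?U" using T finite_ball by auto
  then have "infinite (carrier G - ?U)" using assms by simp
  then have "carrier G - ?U \<noteq> {}" by (rule infinite_imp_nonempty)
  then obtain a where "a \<in> carrier G - ?U" unfolding ex_in_conv[symmetric] by (rule exE)
  then have a: "a \<in> carrier G" "a \<notin> T" "\<forall>x\<in>T. graph_dist E x a > r"
    by (auto simp: not_le)
  then have "\<forall>x\<in>insert a T. \<forall>y\<in>insert a T. x \<noteq> y \<longrightarrow> graph_dist E x y > r"
    using T(4) graph_dist_commute by (metis insert_iff)
  then show ?case using a T by (intro exI[of _ "insert a T"]) simp
qed

section \<open>Left translations of configurations\<close>

lemma linked_translate:
  assumes "linked \<omega> x y"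
  shows "linked (translate G g \<omega>) (g \<otimes> x) (g \<otimes> y)"
  using assms unfolding linked_def
proof induction
  case base
  show ?case by simp
next
  case (step y z)
  have "(g \<otimes> y, g \<otimes> z) \<in> adjacency (translate G g \<omega>)"
    using step(2) by (auto simp: adjacency_def translate_def intro!: image_eqI[of _ _ "{y, z}"])
  then show ?case using step(3) by (rule rtrancl_into_rtrancl[rotated])
qed

lemma translate_inv_translate:
  assumes "g \<in> carrier G" "\<omega> \<subseteq> E"
  shows "translate G (inv g) (translate G g \<omega>) = \<omega>"
proof -
  have "(\<lambda>x. inv g \<otimes> x) ` ((\<lambda>x. g \<otimes> x) ` e) = e" if "e \<in> \<omega>" for e
  proof -
    have "e \<subseteq> carrier G" using that assms(2) edge_subset by blast
    then have "\<forall>x\<in>e. inv g \<otimes> (g \<otimes> x) = x"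
      using assms(1) by (auto simp: m_assoc[symmetric])
    then show ?thesis by (simp add: image_image)
  qed
  then show ?thesis by (simp add: translate_def image_image)
qed

text \<open>The converse implication is the forward one for \<open>inv g\<close>, which undoes the
  translation.\<close>

lemma linked_translate_iff:
  assumes "g \<in> carrier G" "x \<in> carrier G" "y \<in> carrier G" "\<omega> \<subseteq> E"
  shows "linked (translate G g \<omega>) (g \<otimes> x) (g \<otimes> y) \<longleftrightarrow> linked \<omega> x y"
proof
  assume "linked (translate G g \<omega>) (g \<otimes> x) (g \<otimes> y)"
  from linked_translate[OF this, of "inv g"] show "linked \<omega> x y"
    using assms translate_inv_translate by (simp add: m_assoc[symmetric])
qed (rule linked_translate)

section \<open>Infinite clusters and their number\<close>

definition in_infinite_cluster :: "'a set set \<Rightarrow> 'a \<Rightarrow> bool" where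
  "in_infinite_cluster \<omega> g \<longleftrightarrow> infinite {h \<in> carrier G. linked \<omega> g h}"

text \<open>Counting infinite clusters through their vertices, as a condition on finite sets of vertices,
  makes the event visibly measurable.\<close>

definition at_most_infinite_clusters :: "nat \<Rightarrow> 'a set set \<Rightarrow> bool" where
  "at_most_infinite_clusters k \<omega> \<longleftrightarrow>
     (\<forall>T\<in>{T. T \<subseteq> carrier G \<and> finite T \<and> card T > k}. (\<forall>t\<in>T. in_infinite_cluster \<omega> t) \<longrightarrow>
        (\<exists>x\<in>T. \<exists>y\<in>T. x \<noteq> y \<and> linked \<omega> x y))"

text \<open>Left multiplication by \<open>g\<close> carries the cluster of \<open>x\<close>
  bijectively onto the cluster of \<open>g \<otimes> x\<close> in the translated
  configuration.\<close>

lemma in_infinite_cluster_translate_iff: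
  assumes "g \<in> carrier G" "x \<in> carrier G" "\<omega> \<subseteq> E"
  shows "in_infinite_cluster (translate G g \<omega>) (g \<otimes> x) \<longleftrightarrow> in_infinite_cluster \<omega> x"
proof -
  have "{h \<in> carrier G. linked (translate G g \<omega>) (g \<otimes> x) h} =
      (\<lambda>y. g \<otimes> y) ` {h \<in> carrier G. linked \<omega> x h}" (is "?L = ?R")
  proof
    show "?L \<subseteq> ?R"
    proof
      fix h assume h: "h \<in> ?L"
      then have "h = g \<otimes> (inv g \<otimes> h)" using assms by (simp add: m_assoc[symmetric])
      moreover from this have "inv g \<otimes> h \<in> {h \<in> carrier G. linked \<omega> x h}"
        using h assms linked_translate_iff[of g x "inv g \<otimes> h" \<omega>] by simp
      ultimately show "h \<in> ?R" by blast
    qed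
    show "?R \<subseteq> ?L" using assms linked_translate by auto
  qed
  moreover have "inj_on (\<lambda>y. g \<otimes> y) {h \<in> carrier G. linked \<omega> x h}"
    using assms by (auto simp: inj_on_def)
  ultimately show ?thesis by (simp add: in_infinite_cluster_def finite_image_iff)
qed

text \<open>A test set for the translated configuration is pulled back by \<open>inv g\<close>,
  injectively so that its size is kept, and the linked pair found there is pushed forward by
  \<open>g\<close>.\<close>

lemma at_most_infinite_clusters_translate:
  assumes g: "g \<in> carrier G" and \<omega>: "\<omega> \<subseteq> E" and few: "at_most_infinite_clusters k \<omega>"
  shows "at_most_infinite_clusters k (translate G g \<omega>)"
  unfolding at_most_infinite_clusters_def
proof (intro ballI impI)
  fix T assume T: "T \<in> {T. T \<subseteq> carrier G \<and> finite T \<and> card T > k}"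
    and inf: "\<forall>t\<in>T. in_infinite_cluster (translate G g \<omega>) t"
  let ?f = "\<lambda>x. inv g \<otimes> x"
  have gf: "g \<otimes> ?f x = x" if "x \<in> T" for x
    using that T g by (auto simp: m_assoc[symmetric])
  then have "inj_on ?f T" by (metis inj_onI)
  then have "?f ` T \<in> {T. T \<subseteq> carrier G \<and> finite T \<and> card T > k}"
    using T g by (auto simp: card_image)
  moreover have "\<forall>t\<in>?f ` T. in_infinite_cluster \<omega> t"
  proof
    fix t assume "t \<in> ?f ` T"
    then obtain x where x: "x \<in> T" "t = ?f x" by blast
    then show "in_infinite_cluster \<omega> t"
      using in_infinite_cluster_translate_iff[of g t \<omega>] gf[of x] inf T g \<omega> by auto
  qed
  ultimately have "\<exists>x\<in>?f ` T. \<exists>y\<in>?f ` T. x \<noteq> y \<and> linked \<omega> x y"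
    by (rule bspec[OF few[unfolded at_most_infinite_clusters_def], THEN mp])
  then obtain x y where xy: "x \<in> T" "y \<in> T" "?f x \<noteq> ?f y" "linked \<omega> (?f x) (?f y)"
    by (elim bexE conjE imageE) simp
  then have "linked (translate G g \<omega>) x y"
    using linked_translate[OF xy(4), of g] by (simp only: gf)
  moreover have "x \<noteq> y" using xy(3) by auto
  ultimately show "\<exists>x\<in>T. \<exists>y\<in>T. x \<noteq> y \<and> linked (translate G g \<omega>) x y"
    by (intro bexI[OF _ xy(1)] bexI[OF _ xy(2)] conjI)
qed

text \<open>Pigeonhole: among more vertices than infinite clusters, two share a cluster. Finiteness
  of the family makes \<open>card\<close> a true count rather than the default 0.\<close>

lemma at_most_infinite_clusters_card:
  assumes "finite {C \<in> clusters G \<omega>. infinite C}"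
  shows "at_most_infinite_clusters (card {C \<in> clusters G \<omega>. infinite C}) \<omega>"
  unfolding at_most_infinite_clusters_def
proof (intro ballI impI)
  let ?K = "{C \<in> clusters G \<omega>. infinite C}" and ?f = "\<lambda>g. {h \<in> carrier G. linked \<omega> g h}"
  fix T assume T: "T \<in> {T. T \<subseteq> carrier G \<and> finite T \<and> card T > card ?K}"
    and inf: "\<forall>t\<in>T. in_infinite_cluster \<omega> t"
  have "?f ` T \<subseteq> ?K" using T inf by (auto simp: clusters_def in_infinite_cluster_def)
  with assms have "card (?f ` T) \<le> card ?K" by (rule card_mono)
  with T have "card (?f ` T) < card T" by simp
  then have "\<not> inj_on ?f T" by (rule pigeonhole)
  then obtain x y where xy: "x \<in> T" "y \<in> T" "x \<noteq> y" "?f x = ?f y"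
    unfolding inj_on_def by blast
  moreover have "y \<in> ?f y" using xy T by (auto simp: linked_def)
  ultimately have "y \<in> ?f x" by (simp only:)
  then have "linked \<omega> x y" by simp
  then show "\<exists>x\<in>T. \<exists>y\<in>T. x \<noteq> y \<and> linked \<omega> x y" using xy by blast
qed

text \<open>The greedy count is applied to the points of \<open>T\<close> in infinite clusters. An
  unlinked set of such points has at most \<open>k\<close> elements, since a larger one would have
  to contain a linked pair.\<close>

lemma card_infinite_cluster_points_le:
  assumes T: "T \<subseteq> carrier G" "finite T" and few: "at_most_infinite_clusters k \<omega>"
  shows "card {t \<in> T. in_infinite_cluster \<omega> t} \<le>
           k + card {(x, y) \<in> T \<times> T. x \<noteq> y \<and> linked \<omega> x y}"
proof -
  let ?X = "{t \<in> T. in_infinite_cluster \<omega> t}"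
  have "finite ?X" using T by simp
  then have "\<exists>U\<subseteq>?X. (\<forall>x\<in>U. \<forall>y\<in>U. x \<noteq> y \<longrightarrow> \<not> linked \<omega> x y) \<and>
      card ?X \<le> card U + card {(x, y) \<in> ?X \<times> ?X. x \<noteq> y \<and> linked \<omega> x y}"
    by (rule finite_set_card_le_independent_plus_pairs) (rule linked_sym)
  then obtain U where U: "U \<subseteq> ?X" "\<forall>x\<in>U. \<forall>y\<in>U. x \<noteq> y \<longrightarrow> \<not> linked \<omega> x y"
    "card ?X \<le> card U + card {(x, y) \<in> ?X \<times> ?X. x \<noteq> y \<and> linked \<omega> x y}"
    by (elim exE conjE)
  have "finite U" using U(1) \<open>finite ?X\<close> by (rule finite_subset)
  have "card U \<le> k"
  proof (rule ccontr)
    assume "\<not> card U \<le> k"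
    with \<open>finite U\<close> have "U \<in> {T. T \<subseteq> carrier G \<and> finite T \<and> card T > k}"
      using U(1) T(1) by auto
    moreover have "\<forall>t\<in>U. in_infinite_cluster \<omega> t" using U(1) by auto
    ultimately have "\<exists>x\<in>U. \<exists>y\<in>U. x \<noteq> y \<and> linked \<omega> x y"
      by (rule bspec[OF few[unfolded at_most_infinite_clusters_def], THEN mp])
    with U(2) show False by blast
  qed
  moreover have "card {(x, y) \<in> ?X \<times> ?X. x \<noteq> y \<and> linked \<omega> x y} \<le>
      card {(x, y) \<in> T \<times> T. x \<noteq> y \<and> linked \<omega> x y}"
    by (intro card_mono finite_subset[OF _ finite_cartesian_product[OF T(2) T(2)]]) auto
  ultimately show ?thesis using U(3) by simp
qed

end

section \<open>Measurability of the cluster events\<close>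

locale cayley_percolation = cayley_graph G S + prob_space P
  for G :: "('a, 'b) monoid_scheme" (structure) and S and P :: "'a set set measure" +
  assumes percolation: "bond_percolation E P"
    and invariant: "translation_invariant G P"
begin

lemma linked_pred [measurable]: "Measurable.pred P (\<lambda>\<omega>. linked \<omega> g h)"
  using linked_event[OF group_axioms generating percolation, of g h] by (simp add: pred_def)

lemma countable_finite_subsets:
  assumes "\<And>T. T \<in> A \<Longrightarrow> T \<subseteq> carrier G \<and> finite T"
  shows "countable A"
  by (rule countable_subset[OF _ countable_Collect_finite_subset
        [OF countable_cayley[OF group_axioms generating]]]) (use assms in blast)

text \<open>A cluster is infinite iff it leaves every finite vertex set, and a countable group has
  only countably many finite subsets.\<close>

lemma in_infinite_cluster_pred [measurable]:
  "Measurable.pred P (\<lambda>\<omega>. in_infinite_cluster \<omega> g)"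
proof -
  have "in_infinite_cluster \<omega> g \<longleftrightarrow>
      (\<forall>F\<in>{F. F \<subseteq> carrier G \<and> finite F}. \<exists>h\<in>carrier G - F. linked \<omega> g h)" for \<omega>
  proof
    assume inf: "in_infinite_cluster \<omega> g"
    show "\<forall>F\<in>{F. F \<subseteq> carrier G \<and> finite F}. \<exists>h\<in>carrier G - F. linked \<omega> g h"
    proof
      fix F assume "F \<in> {F. F \<subseteq> carrier G \<and> finite F}"
      then have "\<not> {h \<in> carrier G. linked \<omega> g h} \<subseteq> F"
        using inf finite_subset by (auto simp: in_infinite_cluster_def)
      then show "\<exists>h\<in>carrier G - F. linked \<omega> g h" by blast
    qed
  next
    assume *: "\<forall>F\<in>{F. F \<subseteq> carrier G \<and> finite F}. \<exists>h\<in>carrier G - F. linked \<omega> g h"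
    show "in_infinite_cluster \<omega> g"
      unfolding in_infinite_cluster_def
    proof
      assume "finite {h \<in> carrier G. linked \<omega> g h}"
      with bspec[OF *, of "{h \<in> carrier G. linked \<omega> g h}"] show False by simp
    qed
  qed
  moreover have "Measurable.pred P (\<lambda>\<omega>. \<forall>F\<in>{F. F \<subseteq> carrier G \<and> finite F}.
      \<exists>h\<in>carrier G - F. linked \<omega> g h)"
    using countable_cayley[OF group_axioms generating]
    by (intro pred_Ball_countable pred_Bex_countable countable_finite_subsets linked_pred) simp_all
  ultimately show ?thesis by simp
qed

text \<open>The outer quantifier runs over a countable family; for each \<open>T\<close> the
  remaining ones are finite.\<close>

lemma at_most_infinite_clusters_pred [measurable]:
  "Measurable.pred P (\<lambda>\<omega>. at_most_infinite_clusters k \<omega>)"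
  unfolding at_most_infinite_clusters_def
proof (rule pred_Ball_countable[OF countable_finite_subsets], simp)
  fix T assume "T \<in> {T. T \<subseteq> carrier G \<and> finite T \<and> card T > k}"
  then have [simp]: "finite T" by simp
  show "Measurable.pred P (\<lambda>\<omega>. (\<forall>t\<in>T. in_infinite_cluster \<omega> t) \<longrightarrow>
      (\<exists>x\<in>T. \<exists>y\<in>T. x \<noteq> y \<and> linked \<omega> x y))"
    by (intro pred_intros_logic pred_intros_finite in_infinite_cluster_pred linked_pred) simp_all
qed

section \<open>Bad events and their probabilities\<close>

text \<open>Wherever the conclusion of the theorem fails, such an event occurs for some vertex
  \<open>g\<close> and some \<open>k\<close>. Attaching the event to a vertex lets invariance
  compare its probabilities.\<close>

definition bad_event :: "nat \<Rightarrow> 'a \<Rightarrow> 'a set set set" where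
  "bad_event k g = {\<omega> \<in> space P. in_infinite_cluster \<omega> g \<and> at_most_infinite_clusters k \<omega>}"

lemma bad_event_sets [measurable]: "bad_event k g \<in> sets P"
  unfolding bad_event_def by measurable

text \<open>Translation by \<open>h\<close> maps \<open>bad_event k g\<close> into
  \<open>bad_event k (h \<otimes> g)\<close>, and invariance gives the preimage of the latter the
  same probability as the event itself.\<close>

lemma prob_bad_event_le_translate:
  assumes "g \<in> carrier G" "h \<in> carrier G"
  shows "prob (bad_event k g) \<le> prob (bad_event k (h \<otimes> g))"
proof -
  have meas: "translate G h \<in> measurable P P"
    using translate_measurable[OF group_axioms generating percolation] assms by simp
  have "bad_event k g \<subseteq> translate G h -` bad_event k (h \<otimes> g) \<inter> space P"
  proof
    fix \<omega> assume \<omega>: "\<omega> \<in> bad_event k g"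
    then have "\<omega> \<in> space P" by (simp add: bad_event_def)
    moreover from this have "\<omega> \<subseteq> E" using space_percolation[OF percolation] by simp
    moreover have "translate G h \<omega> \<in> space P"
      using meas \<open>\<omega> \<in> space P\<close> by (rule measurable_space)
    ultimately show "\<omega> \<in> translate G h -` bad_event k (h \<otimes> g) \<inter> space P"
      using \<omega> assms in_infinite_cluster_translate_iff at_most_infinite_clusters_translate
      by (simp add: bad_event_def)
  qed
  then have "prob (bad_event k g) \<le> prob (translate G h -` bad_event k (h \<otimes> g) \<inter> space P)"
    using meas by (intro finite_measure_mono) auto
  also have "\<dots> = measure (distr P P (translate G h)) (bad_event k (h \<otimes> g))"
    using meas by (simp add: measure_distr)
  also have "distr P P (translate G h) = P"
    using invariant assms by (simp add: translation_invariant_def)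
  finally show ?thesis .
qed

text \<open>First moment bound: the deterministic count holds for every configuration, and its two
  sides, written as sums of indicators, are integrated. The pairs are ordered.\<close>

lemma sum_prob_bad_event_le:
  assumes T: "T \<subseteq> carrier G" "finite T"
  shows "(\<Sum>t\<in>T. prob (bad_event k t)) \<le>
           k + (\<Sum>(x, y)\<in>{(x, y) \<in> T \<times> T. x \<noteq> y}. two_point P x y)"
proof -
  let ?D = "{(x, y) \<in> T \<times> T. x \<noteq> y}"
  let ?L = "\<lambda>(x, y). {\<omega> \<in> space P. linked \<omega> x y}"
  have fin: "finite ?D"
    by (rule finite_subset[OF _ finite_cartesian_product[OF T(2) T(2)]]) auto
  have L: "?L p \<in> sets P" for p
    using linked_event[OF group_axioms generating percolation] by (simp split: prod.split)
  have le: "(\<Sum>t\<in>T. indicator (bad_event k t) \<omega>) \<le> k + (\<Sum>p\<in>?D. indicator (?L p) \<omega> :: real)"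
    if \<omega>: "\<omega> \<in> space P" for \<omega>
  proof (cases "at_most_infinite_clusters k \<omega>")
    case True
    have "{t \<in> T. \<omega> \<in> bad_event k t} = {t \<in> T. in_infinite_cluster \<omega> t}"
      using \<omega> True unfolding bad_event_def by blast
    moreover have "{p \<in> ?D. \<omega> \<in> ?L p} = {(x, y) \<in> T \<times> T. x \<noteq> y \<and> linked \<omega> x y}"
      using \<omega> by auto
    ultimately show ?thesis
      using card_infinite_cluster_points_le[OF T True]
      by (simp only: sum_indicator_family_eq_card[OF T(2)] sum_indicator_family_eq_card[OF fin]
          of_nat_add[symmetric] of_nat_le_iff)
  next
    \<comment> \<open>Every bad event includes the bound on the number of infinite clusters, so here
      the left side is 0.\<close>
    case False
    then have "{t \<in> T. \<omega> \<in> bad_event k t} = {}"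
      unfolding bad_event_def by blast
    then show ?thesis
      by (simp only: sum_indicator_family_eq_card[OF T(2)] sum_indicator_family_eq_card[OF fin]) simp
  qed
  have "(\<Sum>t\<in>T. prob (bad_event k t)) = expectation (\<lambda>\<omega>. \<Sum>t\<in>T. indicator (bad_event k t) \<omega>)"
    by (subst Bochner_Integration.integral_sum) (auto simp: emeasure_eq_measure)
  also have "\<dots> \<le> expectation (\<lambda>\<omega>. k + (\<Sum>p\<in>?D. indicator (?L p) \<omega> :: real))"
    using le L
    by (intro integral_mono Bochner_Integration.integrable_add Bochner_Integration.integrable_sum)
      (auto simp: emeasure_eq_measure intro!: integrable_real_indicator)
  also have "\<dots> = k + (\<Sum>p\<in>?D. prob (?L p))"
  proof -
    have int: "integrable P (indicator (?L p) :: _ \<Rightarrow> real)" for p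
      using L by (intro integrable_real_indicator) (auto simp: emeasure_eq_measure)
    have "expectation (\<lambda>\<omega>. k + (\<Sum>p\<in>?D. indicator (?L p) \<omega> :: real)) =
        expectation (\<lambda>\<omega>. real k) + expectation (\<lambda>\<omega>. \<Sum>p\<in>?D. indicator (?L p) \<omega>)"
      using int by (intro Bochner_Integration.integral_add) auto
    also have "expectation (\<lambda>\<omega>. \<Sum>p\<in>?D. indicator (?L p) \<omega>) = (\<Sum>p\<in>?D. prob (?L p))"
      using int L by (subst Bochner_Integration.integral_sum) auto
    finally show ?thesis by (simp add: prob_space)
  qed
  also have "(\<Sum>p\<in>?D. prob (?L p)) = (\<Sum>(x, y)\<in>?D. two_point P x y)"
    by (intro sum.cong) (auto simp: two_point_def)
  finally show ?thesis .
qed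

lemma two_point_small_at_distance:
  assumes "vanishes_at_infinity G S (two_point P)" and "\<epsilon> > 0"
  obtains r where "\<And>g h. g \<in> carrier G \<Longrightarrow> h \<in> carrier G \<Longrightarrow> graph_dist E g h > r \<Longrightarrow>
    two_point P g h < \<epsilon>"
proof -
  let ?far = "\<lambda>r. {(g, h). g \<in> carrier G \<and> h \<in> carrier G \<and> graph_dist E g h > r}"
  have "eventually (\<lambda>r. (SUP (g, h) \<in> ?far r. two_point P g h) < \<epsilon>) sequentially"
    using assms by (auto simp: vanishes_at_infinity_def intro: order_tendstoD)
  then obtain r where r: "(SUP (g, h) \<in> ?far r. two_point P g h) < \<epsilon>"
    by (auto simp: eventually_sequentially)
  \<comment> \<open>A real \<open>SUP\<close> is known to dominate its members only when they are
    bounded above; probabilities are bounded by 1.\<close>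
  have bdd: "bdd_above ((\<lambda>(g, h). two_point P g h) ` ?far r)"
    by (rule bdd_aboveI[of _ 1]) (auto simp: two_point_def)
  show ?thesis
  proof (rule that)
    fix g h assume "g \<in> carrier G" "h \<in> carrier G" "graph_dist E g h > r"
    then have "two_point P g h \<le> (SUP (g, h) \<in> ?far r. two_point P g h)"
      using cSUP_upper[OF _ bdd, of "(g, h)"] by simp
    then show "two_point P g h < \<epsilon>" using r by simp
  qed
qed

lemma prob_bad_event_eq_0:
  assumes inf: "infinite (carrier G)" and van: "vanishes_at_infinity G S (two_point P)"
    and g: "g \<in> carrier G"
  shows "prob (bad_event k g) = 0"
proof (rule ccontr)
  assume "prob (bad_event k g) \<noteq> 0"
  then have p: "prob (bad_event k g) > 0" by (simp add: zero_less_measure_iff)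
  obtain n :: nat where n: "real n * prob (bad_event k g) > k + 1"
    using reals_Archimedean3[OF p] by metis
  \<comment> \<open>For \<open>n = 0\<close> the choice of \<open>n\<close> would read
    \<open>0 > k + 1\<close>. Positivity makes \<open>?\<epsilon>\<close> positive, as division by
    zero yields 0.\<close>
  have n0: "n > 0" using n by (cases n) auto
  \<comment> \<open>There are at most \<open>n * n\<close> ordered pairs in \<open>?D\<close>, so
    the two-point sum stays at most 1, while \<open>n\<close> was chosen so that the left side
    exceeds \<open>k + 1\<close>.\<close>
  let ?\<epsilon> = "1 / real (n * n)"
  obtain r where r: "\<And>g h. g \<in> carrier G \<Longrightarrow> h \<in> carrier G \<Longrightarrow> graph_dist E g h > r \<Longrightarrow>
    two_point P g h < ?\<epsilon>"
    using two_point_small_at_distance[OF van, of ?\<epsilon>] n0 by auto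
  obtain T where T: "T \<subseteq> carrier G" "finite T" "card T = n"
    "\<forall>x\<in>T. \<forall>y\<in>T. x \<noteq> y \<longrightarrow> graph_dist E x y > r"
    using ex_separated_set[OF inf, of n r] by (elim exE conjE)
  let ?D = "{(x, y) \<in> T \<times> T. x \<noteq> y}"
  \<comment> \<open>Left multiplication by \<open>t \<otimes> inv g\<close> moves \<open>g\<close>
    to \<open>t\<close>.\<close>
  have "prob (bad_event k g) \<le> prob (bad_event k t)" if "t \<in> T" for t
  proof -
    have t: "t \<in> carrier G" using that T(1) by (rule set_mp[rotated])
    then have "t \<otimes> inv g \<otimes> g = t" using g by (simp add: m_assoc)
    then show ?thesis using prob_bad_event_le_translate[OF g, of "t \<otimes> inv g" k] t g by simp
  qed
  then have "real n * prob (bad_event k g) \<le> (\<Sum>t\<in>T. prob (bad_event k t))"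
    using sum_bounded_below[of T "prob (bad_event k g)" "\<lambda>t. prob (bad_event k t)"] T(3) by simp
  also have "\<dots> \<le> k + (\<Sum>(x, y)\<in>?D. two_point P x y)"
    by (rule sum_prob_bad_event_le[OF T(1,2)])
  also have "(\<Sum>(x, y)\<in>?D. two_point P x y) \<le> real (card ?D) * ?\<epsilon>"
  proof (rule sum_bounded_above)
    fix p assume p: "p \<in> ?D"
    obtain x y where [simp]: "p = (x, y)" by (cases p)
    have "x \<in> T" "y \<in> T" "x \<noteq> y" using p by simp_all
    with T(1,4) have "two_point P x y < ?\<epsilon>" by (intro r) (simp_all add: subset_iff)
    then show "(case p of (x, y) \<Rightarrow> two_point P x y) \<le> ?\<epsilon>" by simp
  qed
  also have "\<dots> \<le> real (n * n) * ?\<epsilon>"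
  proof -
    have "card ?D \<le> card (T \<times> T)"
      by (rule card_mono[OF finite_cartesian_product[OF T(2) T(2)]]) auto
    then have "real (card ?D) \<le> real (n * n)"
      unfolding card_cartesian_product T(3) by (rule of_nat_mono)
    then show ?thesis by (rule mult_right_mono) simp
  qed
  also have "\<dots> = 1" using n0 by simp
  finally show False using n by simp
qed

text \<open>Countably many null events, indexed by vertices and by \<open>k\<close>, are discarded
  together.\<close>

lemma AE_finite_clusters_or_infinitely_many:
  assumes "infinite (carrier G)" "vanishes_at_infinity G S (two_point P)"
  shows "AE \<omega> in P. (\<forall>C \<in> clusters G \<omega>. finite C) \<or> infinite {C \<in> clusters G \<omega>. infinite C}"
proof -
  have "AE \<omega> in P. \<omega> \<notin> bad_event k g" if "g \<in> carrier G" for k g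
    using prob_bad_event_eq_0[OF assms that]
    by (intro AE_not_in) (auto simp: null_sets_def emeasure_eq_measure)
  then have "AE \<omega> in P. \<forall>g\<in>carrier G. \<forall>k. \<omega> \<notin> bad_event k g"
    using countable_cayley[OF group_axioms generating]
    by (simp add: AE_ball_countable AE_all_countable)
  then show ?thesis
    using AE_space
  proof eventually_elim
    case (elim \<omega>)
    show ?case
    proof (rule ccontr)
      assume neg: "\<not> ?thesis"
      then obtain g where "g \<in> carrier G" "in_infinite_cluster \<omega> g"
        by (auto simp: clusters_def in_infinite_cluster_def)
      \<comment> \<open>The bound is the actual number of infinite clusters, finite by
        \<open>neg\<close>. It depends on \<open>\<omega>\<close>, which is why all \<open>k\<close>
        were excluded simultaneously.\<close>
      moreover have "at_most_infinite_clusters (card {C \<in> clusters G \<omega>. infinite C}) \<omega>"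
        using neg by (intro at_most_infinite_clusters_card) simp
      ultimately show False using elim by (auto simp: bad_event_def)
    qed
  qed
qed

end

theorem proposition3p11:
  fixes G :: "('a, 'b) monoid_scheme" and S :: "'a set" and P :: "'a set set measure"
  assumes "group G" and "infinite (carrier G)"
    and "finite_symmetric_generating_set G S"
    and "bond_percolation (cayley_edges G S) P"
    and "translation_invariant G P"
    and "vanishes_at_infinity G S (two_point P)"
  shows "AE \<omega> in P. (\<forall>C \<in> clusters G \<omega>. finite C) \<or> infinite {C \<in> clusters G \<omega>. infinite C}"
proof -
  interpret group G by fact
  interpret prob_space P using assms(4) by (simp add: bond_percolation_def)
  interpret cayley_percolation G S P
    using assms by unfold_locales
  show ?thesis by (rule AE_finite_clusters_or_infinitely_many) fact+
qed

end
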